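(* Let $G=(V,E)$ be an undirected graph with edge weights $w:E\to\{0,1,\dots,W\}$, let $r$ be an EC-SNDP requirement function with maximum requirement $k$, and let $t\ge1$ be an integer. Let $H$ be the output of the streaming greedy edge-fault-tolerant spanner algorithm (described in the context) run on the edges of $G$ in an arbitrary order with parameters $t$, $f=(2t-1)(2k-1)$ and $\epsilon=1/(2t-1)$. Then the optimal value of the cut-based LP relaxation of EC-SNDP on $(H,r)$ is at most $4t$ times the minimum weight of a feasible (integral) solution of the EC-SNDP instance $(G,r)$.
   Context: EC-SNDP: given $G=(V,E)$ with nonnegative edge weights and integers $r(uv)\ge0$ for unordered pairs $u,v\in V$, find a minimum-weight subgraph in which every pair $u,v$ has $r(uv)$ edge-disjoint paths; assume the instance on $G$ is feasible. Cut-based LP relaxation on a graph $(V,E')$: minimize $\sum_{e\in E'}w(e)x(e)$ subject to $\sum_{e\in\delta_{E'}(S)}x(e)\ge\max_{u\in S,v\in V\setminus S}r(uv)$ for all $\emptyset\ne S\subsetneq V$, and $0\le x(e)\le 1$, where $\delta_{E'}(S)$ is the set of edges of $E'$ with exactly one endpoint in $S$. Streaming greedy edge-fault-tolerant (EFT) spanner algorithm with parameters $(t,f,\epsilon)$: buckets $B_0=\{0\}$, $B_i=[(1+\epsilon)^{i-1},(1+\epsilon)^i)$ for $i=1,\dots,T$ covering $\{1,\dots,W\}$; start with $H_i=(V,\emptyset)$; for each arriving edge $(u,v)$ with $w(u,v)\in B_j$, add it to $H_j$ if there is a set $F$ of at most $f$ edges such that the unweighted (hop) distance between $u$ and $v$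 in $H_j$ with the edges of $F$ removed exceeds $2t-1$; output $H=\bigcup_i H_i$. *)

theory Defs
  imports Complex_Main "HOL-Library.Extended_Real" "HOL-Library.Extended_Nat"
begin

definition ugraph :: "'a set \<Rightarrow> 'a set set \<Rightarrow> bool" where
  "ugraph V E \<longleftrightarrow> finite V \<and> (\<forall>e\<in>E. \<exists>u\<in>V. \<exists>v\<in>V. u \<noteq> v \<and> e = {u, v})"

definition path_edges :: "'a list \<Rightarrow> 'a set list" where
  "path_edges p = map2 (\<lambda>u v. {u, v}) p (tl p)"

definition is_path :: "'a set set \<Rightarrow> 'a \<Rightarrow> 'a \<Rightarrow> 'a list \<Rightarrow> bool" where
  "is_path E u v p \<longleftrightarrow>
     p \<noteq> [] \<and> hd p = u \<and> last p = v \<and> distinct p \<and> set (path_edges p) \<subseteq> E"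

definition has_edge_disjoint_paths :: "'a set set \<Rightarrow> 'a \<Rightarrow> 'a \<Rightarrow> nat \<Rightarrow> bool" where
  "has_edge_disjoint_paths E u v n \<longleftrightarrow>
     (\<exists>P. finite P \<and> card P = n \<and> (\<forall>p\<in>P. is_path E u v p) \<and>
          pairwise (\<lambda>p q. disjnt (set (path_edges p)) (set (path_edges q))) P)"

text \<open>The hop distance is \<open>\<infinity>\<close> if there is no path.\<close>

definition hop_dist :: "'a set set \<Rightarrow> 'a \<Rightarrow> 'a \<Rightarrow> enat" where
  "hop_dist E u v = (INF p\<in>{p. is_path E u v p}. enat (length (path_edges p)))"

text \<open>A requirement function \<open>r\<close> is given on unordered pairs \<open>{u, v}\<close> with \<open>u \<noteq> v\<close>;
  its values on other sets are irrelevant.\<close>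

definition max_requirement :: "'a set \<Rightarrow> ('a set \<Rightarrow> nat) \<Rightarrow> nat" where
  "max_requirement V r = Max (insert 0 {r {u, v} | u v. u \<in> V \<and> v \<in> V \<and> u \<noteq> v})"

definition sndp_feasible :: "'a set \<Rightarrow> ('a set \<Rightarrow> nat) \<Rightarrow> 'a set set \<Rightarrow> bool" where
  "sndp_feasible V r F \<longleftrightarrow>
     (\<forall>u\<in>V. \<forall>v\<in>V. u \<noteq> v \<longrightarrow> has_edge_disjoint_paths F u v (r {u, v}))"

definition sndp_opt :: "'a set \<Rightarrow> 'a set set \<Rightarrow> ('a set \<Rightarrow> nat) \<Rightarrow> ('a set \<Rightarrow> nat) \<Rightarrow> nat" where
  "sndp_opt V E w r = Min {(\<Sum>e\<in>F. w e) | F. F \<subseteq> E \<and> sndp_feasible V r F}"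

definition cut_edges :: "'a set set \<Rightarrow> 'a set \<Rightarrow> 'a set set" where
  "cut_edges E S = {e \<in> E. card (e \<inter> S) = 1}"

definition lp_feasible ::
    "'a set \<Rightarrow> 'a set set \<Rightarrow> ('a set \<Rightarrow> nat) \<Rightarrow> ('a set \<Rightarrow> real) \<Rightarrow> bool" where
  "lp_feasible V E r x \<longleftrightarrow>
     (\<forall>S. S \<noteq> {} \<and> S \<subset> V \<longrightarrow>
        (\<Sum>e\<in>cut_edges E S. x e) \<ge> real (Max {r {u, v} | u v. u \<in> S \<and> v \<in> V - S})) \<and>
     (\<forall>e\<in>E. 0 \<le> x e \<and> x e \<le> 1)"

text \<open>The optimal value is taken in the extended reals, so that it is \<open>\<infinity>\<close> for an infeasible LP.\<close>

definition lp_opt :: "'a set \<Rightarrow> 'a set set \<Rightarrow> ('a set \<Rightarrow> nat) \<Rightarrow> ('a set \<Rightarrow> nat) \<Rightarrow> ereal" where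
  "lp_opt V E w r = (INF x\<in>{x. lp_feasible V E r x}. ereal (\<Sum>e\<in>E. real (w e) * x e))"

definition bucket :: "real \<Rightarrow> nat \<Rightarrow> real set" where
  "bucket \<epsilon> i = (if i = 0 then {0} else {(1 + \<epsilon>) ^ (i - 1) ..< (1 + \<epsilon>) ^ i})"

text \<open>The state of the algorithm maps each bucket index \<open>j\<close> to the edge set of \<open>H\<^sub>j\<close>. The fault
  parameter \<open>f\<close> is an integer so that \<open>(2 * t - 1) * (2 * k - 1)\<close> needs no truncated
  subtraction.\<close>

definition eft_step ::
    "nat \<Rightarrow> int \<Rightarrow> real \<Rightarrow> ('a set \<Rightarrow> nat) \<Rightarrow> 'a set \<Rightarrow> (nat \<Rightarrow> 'a set set) \<Rightarrow> (nat \<Rightarrow> 'a set set)" where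
  "eft_step t f \<epsilon> w e H = (\<lambda>j.
     if real (w e) \<in> bucket \<epsilon> j \<and>
        (\<exists>u v F. e = {u, v} \<and> F \<subseteq> H j \<and> int (card F) \<le> f \<and>
                 hop_dist (H j - F) u v > enat (2 * t - 1))
     then insert e (H j) else H j)"

definition eft_spanner ::
    "nat \<Rightarrow> int \<Rightarrow> real \<Rightarrow> nat \<Rightarrow> ('a set \<Rightarrow> nat) \<Rightarrow> 'a set list \<Rightarrow> 'a set set" where
  "eft_spanner t f \<epsilon> T w es = (\<Union>i\<le>T. fold (eft_step t f \<epsilon> w) es (\<lambda>_. {}) i)"

end

theory Submission
  imports Defs
begin

text \<open>Let \<open>F\<close> be an optimal integral solution. An edge \<open>e \<in> F\<close> that the algorithm rejected has, by a
  greedy argument, \<open>2k\<close> edge-disjoint detours of at most \<open>2t - 1\<close> hops in its own bucket of \<open>H\<close>; let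
  \<open>D e\<close> be the union of these detours. Put \<open>x = 1\<close> on \<open>F \<inter> H\<close>, and on every other edge \<open>h\<close> let
  \<open>x h\<close> be \<open>1/k\<close> times the number of rejected \<open>e \<in> F\<close> with \<open>h \<in> D e\<close>, capped at \<open>1\<close>.

  A rejected edge costs at most \<open>(1/k) * 2k * (2t - 1) * (1 + \<epsilon>) * w e = 4t * w e\<close>.
  For feasibility, consider a cut of requirement \<open>R \<le> k\<close> which contains \<open>a < R\<close> edges of \<open>F \<inter> H\<close>, and
  choose \<open>R - a\<close> rejected edges of \<open>F\<close> in the cut. At most \<open>a\<close> of the \<open>2k\<close> cut edges in each \<open>D e\<close>
  are lost to \<open>F \<inter> H\<close>, so at least \<open>k\<close> others receive \<open>1/k\<close> from \<open>e\<close>; since only \<open>R - a \<le> k\<close>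
  rejected edges were chosen, the cap does not matter for their contributions.\<close>

section \<open>Paths crossing cuts\<close>

lemma path_edges_Cons_Cons: "path_edges (a # b # p) = {a, b} # path_edges (b # p)"
  by (simp add: path_edges_def)

text \<open>Either the first edge changes sides, or the rest of the list still has its ends on
  opposite sides.\<close>

lemma path_edges_crossing:
  assumes "p \<noteq> []" and "(hd p \<in> S) \<noteq> (last p \<in> S)"
  shows "\<exists>e\<in>set (path_edges p). card (e \<inter> S) = 1"
  using assms
proof (induction p)
  case (Cons a p)
  show ?case
  proof (cases p)
    case (Cons b q)
    show ?thesis
    proof (cases "(a \<in> S) = (b \<in> S)")
      case True
      then have "(hd p \<in> S) \<noteq> (last p \<in> S)"
        using Cons.prems(2) Cons by simp
      then have "\<exists>e\<in>set (path_edges p). card (e \<inter> S) = 1"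
        using Cons.IH Cons by blast
      then show ?thesis
        unfolding Cons path_edges_Cons_Cons by (meson list.set_intros(2))
    next
      case False
      then have "{a, b} \<inter> S = {a} \<or> {a, b} \<inter> S = {b}"
        by auto
      then have "card ({a, b} \<inter> S) = 1"
        by auto
      with Cons show ?thesis
        by (simp add: path_edges_Cons_Cons)
    qed
  qed (use Cons.prems in auto)
qed simp

lemma is_path_crossing:
  assumes "is_path E u v p" and "(u \<in> S) \<noteq> (v \<in> S)"
  shows "\<exists>e\<in>set (path_edges p). card (e \<inter> S) = 1"
  using assms path_edges_crossing[of p S] by (auto simp: is_path_def)

text \<open>The easy direction of Menger's theorem: picking one crossing edge from each path is
  injective because the paths share no edge.\<close>

lemma edge_disjoint_paths_le_cut:
  assumes "has_edge_disjoint_paths E u v n" and "u \<in> S" and "v \<notin> S" and "finite E"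
  shows "n \<le> card (cut_edges E S)"
proof -
  obtain P where P: "card P = n" "\<forall>p\<in>P. is_path E u v p"
    "pairwise (\<lambda>p q. disjnt (set (path_edges p)) (set (path_edges q))) P"
    using assms(1) by (auto simp: has_edge_disjoint_paths_def)
  have "\<forall>p\<in>P. \<exists>e\<in>set (path_edges p). card (e \<inter> S) = 1"
    using P(2) is_path_crossing[of E u v _ S] assms(2,3) by simp
  then obtain c where c: "\<forall>p\<in>P. c p \<in> set (path_edges p) \<and> card (c p \<inter> S) = 1"
    unfolding Bex_def by (rule bchoice[THEN exE])
  have "inj_on c P"
  proof (rule inj_onI, rule ccontr)
    fix p q assume pq: "p \<in> P" "q \<in> P" "c p = c q" "p \<noteq> q"
    then have "disjnt (set (path_edges p)) (set (path_edges q))"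
      using P(3) by (simp add: pairwise_def)
    with c pq show False by (metis disjnt_iff)
  qed
  moreover have "c ` P \<subseteq> cut_edges E S"
    using c P(2) by (auto simp: cut_edges_def is_path_def)
  moreover have "finite (cut_edges E S)"
    using assms(4) by (simp add: cut_edges_def)
  ultimately show ?thesis
    using P(1) card_inj_on_le by blast
qed

section \<open>Disjoint detours from fault tolerance\<close>

lemma short_path_of_hop_dist:
  assumes "hop_dist E u v \<le> enat n"
  shows "\<exists>p. is_path E u v p \<and> length (path_edges p) \<le> n"
proof (rule ccontr)
  assume "\<not> ?thesis"
  then have "\<And>p. is_path E u v p \<Longrightarrow> enat (Suc n) \<le> enat (length (path_edges p))"
    by (simp add: not_le Suc_le_eq)
  then have "enat (Suc n) \<le> hop_dist E u v"
    unfolding hop_dist_def by (intro INF_greatest) simp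
  with assms have "enat (Suc n) \<le> enat n"
    by (rule order_trans[rotated])
  then show False by simp
qed

text \<open>Greedy choice: the detours found so far form the next fault set, so each new detour
  avoids all of them. Only their union is kept, since the LP sees them solely through the cuts they
  cross.\<close>

lemma fault_tolerant_detours:
  assumes "finite H"
    and "\<And>F. F \<subseteq> H \<Longrightarrow> card F \<le> L * (n - 1) \<Longrightarrow>
           \<exists>p. is_path (H - F) u v p \<and> length (path_edges p) \<le> L"
  shows "\<exists>D\<subseteq>H. card D \<le> L * n \<and>
           (\<forall>S. (u \<in> S) \<noteq> (v \<in> S) \<longrightarrow> n \<le> card (cut_edges D S))"
  using assms(2)
proof (induction n)
  case 0
  show ?case by (intro exI[of _ "{}"]) auto
next
  case (Suc n)
  have "\<exists>D\<subseteq>H. card D \<le> L * n \<and> (\<forall>S. (u \<in> S) \<noteq> (v \<in> S) \<longrightarrow> n \<le> card (cut_edges D S))"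
  proof (rule Suc.IH)
    fix F assume "F \<subseteq> H" "card F \<le> L * (n - 1)"
    moreover have "L * (n - 1) \<le> L * (Suc n - 1)" by simp
    ultimately show "\<exists>p. is_path (H - F) u v p \<and> length (path_edges p) \<le> L"
      using Suc.prems le_trans by blast
  qed
  then obtain D where D: "D \<subseteq> H" "card D \<le> L * n"
    "\<And>S. (u \<in> S) \<noteq> (v \<in> S) \<Longrightarrow> n \<le> card (cut_edges D S)"
    by blast
  \<comment> \<open>\<open>D\<close> itself is the fault set; its size \<open>L * n\<close> is
    exactly the budget for \<open>Suc n\<close>.\<close>
  obtain p where p: "is_path (H - D) u v p" "length (path_edges p) \<le> L"
    using Suc.prems[of D] D by auto
  let ?P = "set (path_edges p)"
  have P: "?P \<subseteq> H - D" "card ?P \<le> L"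
    using p card_length[of "path_edges p"] by (auto simp: is_path_def)
  have fin: "finite D"
    using D(1) assms(1) finite_subset by blast
  have "Suc n \<le> card (cut_edges (D \<union> ?P) S)" if S: "(u \<in> S) \<noteq> (v \<in> S)" for S
  proof -
    obtain e where e: "e \<in> ?P" "card (e \<inter> S) = 1"
      using is_path_crossing[OF p(1) S] by blast
    \<comment> \<open>The new path avoids \<open>D\<close>, so its crossing edge \<open>e\<close> is
      not yet counted.\<close>
    have "Suc n \<le> card (insert e (cut_edges D S))"
      using D(3)[OF S] e P fin by (subst card_insert_disjoint) (auto simp: cut_edges_def)
    also have "\<dots> \<le> card (cut_edges (D \<union> ?P) S)"
      using e fin by (intro card_mono) (auto simp: cut_edges_def)
    finally show ?thesis .
  qed
  moreover have "card (D \<union> ?P) \<le> L * Suc n"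
    using card_Un_le[of D ?P] D(2) P(2) by simp
  moreover have "D \<union> ?P \<subseteq> H"
    using D P by blast
  ultimately show ?case by blast
qed

section \<open>Invariants of the streaming algorithm\<close>

lemma eft_step_mono: "H j \<subseteq> eft_step t f \<epsilon> w e H j"
  by (auto simp: eft_step_def)

lemma fold_eft_step_mono: "H j \<subseteq> fold (eft_step t f \<epsilon> w) es H j"
proof (induction es arbitrary: H)
  case (Cons e es)
  have "H j \<subseteq> eft_step t f \<epsilon> w e H j" by (rule eft_step_mono)
  also have "\<dots> \<subseteq> fold (eft_step t f \<epsilon> w) (e # es) H j"
    using Cons.IH by simp
  finally show ?case .
qed simp

lemma fold_eft_step_subset:
  "fold (eft_step t f \<epsilon> w) es H j \<subseteq> H j \<union> {e \<in> set es. real (w e) \<in> bucket \<epsilon> j}"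
proof (induction es arbitrary: H)
  case (Cons e es)
  have "eft_step t f \<epsilon> w e H j \<subseteq> H j \<union> {e' \<in> {e}. real (w e') \<in> bucket \<epsilon> j}"
    by (auto simp: eft_step_def)
  with Cons.IH[of "eft_step t f \<epsilon> w e H"] show ?case
    by fastforce
qed simp

text \<open>The witness \<open>H\<close> is the state of the bucket when the edge arrived. Rejection
  guarantees a short path there under every admissible fault set, and edges are never deleted
  later.\<close>

lemma rejected_edge_short_path:
  assumes "{u, v} \<in> set es" and "real (w {u, v}) \<in> bucket \<epsilon> j"
    and "{u, v} \<notin> fold (eft_step t f \<epsilon> w) es (\<lambda>_. {}) j"
  shows "\<exists>H\<subseteq>fold (eft_step t f \<epsilon> w) es (\<lambda>_. {}) j. \<forall>F\<subseteq>H. int (card F) \<le> f \<longrightarrow>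
           (\<exists>p. is_path (H - F) u v p \<and> length (path_edges p) \<le> 2 * t - 1)"
proof -
  obtain xs ys where es: "es = xs @ {u, v} # ys"
    using assms(1) by (meson split_list)
  define K where "K = fold (eft_step t f \<epsilon> w) xs (\<lambda>_. {})"
  have fold_es: "fold (eft_step t f \<epsilon> w) es (\<lambda>_. {}) =
      fold (eft_step t f \<epsilon> w) ys (eft_step t f \<epsilon> w {u, v} K)"
    by (simp add: es K_def)
  have sub: "eft_step t f \<epsilon> w {u, v} K j \<subseteq> fold (eft_step t f \<epsilon> w) es (\<lambda>_. {}) j"
    unfolding fold_es by (rule fold_eft_step_mono)
  \<comment> \<open>By monotonicity, absence from the final graph means rejection at this very
    step.\<close>
  then have "{u, v} \<notin> eft_step t f \<epsilon> w {u, v} K j"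
    using assms(3) by blast
  then have short: "hop_dist (K j - F) u v \<le> enat (2 * t - 1)"
    if "F \<subseteq> K j" "int (card F) \<le> f" for F
    using that assms(2) unfolding eft_step_def by (auto split: if_splits simp: not_less)
  have "K j \<subseteq> fold (eft_step t f \<epsilon> w) es (\<lambda>_. {}) j"
    using eft_step_mono sub by blast
  with short show ?thesis
    by (intro exI[of _ "K j"]) (blast intro: short_path_of_hop_dist)
qed

text \<open>Turns the bound on the number of detour edges into a bound on their weight. In bucket 0
  both values are zero.\<close>

lemma bucket_ratio:
  assumes "a \<in> bucket \<epsilon> j" and "b \<in> bucket \<epsilon> j" and "\<epsilon> > 0"
  shows "a \<le> (1 + \<epsilon>) * b"
proof (cases j)
  case 0
  with assms show ?thesis by (simp add: bucket_def)
next
  case (Suc i)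
  then have "a \<le> (1 + \<epsilon>) * (1 + \<epsilon>) ^ i" "(1 + \<epsilon>) ^ i \<le> b"
    using assms by (auto simp: bucket_def)
  then show ?thesis
    using assms(3) mult_left_mono[of "(1 + \<epsilon>) ^ i" b "1 + \<epsilon>"] by linarith
qed

section \<open>The fractional solution: feasibility and cost\<close>

text \<open>The test is \<open>h \<in> F\<close> rather than \<open>h \<in> F \<inter> H\<close>
  because values are only read on edges of \<open>H\<close>.\<close>

definition spread_solution ::
    "nat \<Rightarrow> 'a set set \<Rightarrow> 'a set set \<Rightarrow> ('a set \<Rightarrow> 'a set set) \<Rightarrow> 'a set \<Rightarrow> real" where
  "spread_solution k F H D h =
     (if h \<in> F then 1 else min 1 (real (card {e \<in> F - H. h \<in> D e}) / real k))"

text \<open>Double counting of the pairs \<open>(e, h)\<close> with \<open>e\<close> a chosen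
  rejected edge and \<open>h \<in> D e\<close> a cut edge outside \<open>F\<close>: each
  \<open>e\<close> lies in at least \<open>k\<close> pairs, and each pair contributes
  \<open>1/k\<close>.\<close>

lemma spread_solution_cut:
  assumes "finite H" and "finite F" and "R \<le> k" and "R \<le> card (cut_edges F S)"
    and D: "\<And>e. e \<in> F - H \<Longrightarrow> D e \<subseteq> H"
    and D_cut: "\<And>e. e \<in> cut_edges (F - H) S \<Longrightarrow> 2 * k \<le> card (cut_edges (D e) S)"
  shows "real R \<le> (\<Sum>h\<in>cut_edges H S. spread_solution k F H D h)"
proof -
  let ?x = "spread_solution k F H D"
  define A where "A = cut_edges (F \<inter> H) S"
  define C where "C = cut_edges H S"
  have fin: "finite A" "finite C"
    using assms(1,2) by (auto simp: A_def C_def cut_edges_def)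
  have "A \<subseteq> C" by (auto simp: A_def C_def cut_edges_def)
  then have sum_split: "(\<Sum>h\<in>C. ?x h) = (\<Sum>h\<in>C - A. ?x h) + (\<Sum>h\<in>A. ?x h)"
    using fin by (simp add: sum.subset_diff)
  have sum_A: "(\<Sum>h\<in>A. ?x h) = real (card A)"
    by (simp add: spread_solution_def A_def cut_edges_def)
  show ?thesis
  proof (cases "R \<le> card A")
    case True
    have "(\<Sum>h\<in>C - A. ?x h) \<ge> 0"
      by (intro sum_nonneg) (simp add: spread_solution_def)
    with True sum_split sum_A show ?thesis by (simp add: C_def)
  next
    case False
    then have "k > 0" using assms(3) by simp
    have "cut_edges F S = A \<union> cut_edges (F - H) S"
      by (auto simp: A_def cut_edges_def)
    then have "R - card A \<le> card (cut_edges (F - H) S)"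
      using assms(4) card_Un_le[of A "cut_edges (F - H) S"] by simp
    \<comment> \<open>Taking exactly \<open>R - card A\<close> edges, not all of them, keeps every
      count below at most \<open>k\<close>, so it survives the cap at 1.\<close>
    then obtain M where M: "M \<subseteq> cut_edges (F - H) S" "card M = R - card A" "finite M"
      by (meson obtain_subset_with_card_n)
    have M_F: "M \<subseteq> F - H" using M(1) by (auto simp: cut_edges_def)
    have x_ge: "real (card {e \<in> M. h \<in> D e}) / real k \<le> ?x h" if "h \<in> C - A" for h
    proof -
      have "h \<notin> F" using that by (auto simp: A_def C_def cut_edges_def)
      moreover have "card {e \<in> M. h \<in> D e} \<le> card {e \<in> F - H. h \<in> D e}"
        using M_F assms(2) by (intro card_mono) auto
      moreover have "card {e \<in> M. h \<in> D e} \<le> k"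
        using card_mono[of M "{e \<in> M. h \<in> D e}"] M assms(3) by auto
      ultimately show ?thesis
        using \<open>k > 0\<close> by (simp add: spread_solution_def divide_right_mono)
    qed
    have loss: "k \<le> card {h \<in> C - A. h \<in> D e}" if "e \<in> M" for e
    proof -
      have "cut_edges (D e) S \<subseteq> A \<union> {h \<in> C - A. h \<in> D e}"
        using D M_F that by (auto simp: C_def cut_edges_def)
      then have "card (cut_edges (D e) S) \<le> card (A \<union> {h \<in> C - A. h \<in> D e})"
        using fin by (intro card_mono) auto
      also have "\<dots> \<le> card A + card {h \<in> C - A. h \<in> D e}"
        by (rule card_Un_le)
      \<comment> \<open>Here \<open>card A < R \<le> k\<close>, so removing \<open>A\<close> from at
        least \<open>2 * k\<close> cut edges leaves at least \<open>k\<close>.\<close>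
      finally show ?thesis
        using D_cut[of e] that M(1) False assms(3) by auto
    qed
    have "(R - card A) * k \<le> (\<Sum>e\<in>M. card {h \<in> C - A. h \<in> D e})"
      using sum_bounded_below[of M k, OF loss] M(2) by simp
    also have "\<dots> = (\<Sum>h\<in>C - A. card {e \<in> M. h \<in> D e})"
      using sum.swap_restrict[of M "C - A" "\<lambda>_ _. 1::nat" "\<lambda>e h. h \<in> D e"] M(3) fin by simp
    finally have "real ((R - card A) * k) \<le> real (\<Sum>h\<in>C - A. card {e \<in> M. h \<in> D e})"
      by (simp only: of_nat_le_iff)
    then have "real (R - card A) \<le> (\<Sum>h\<in>C - A. real (card {e \<in> M. h \<in> D e}) / real k)"
      using \<open>k > 0\<close> by (simp add: pos_le_divide_eq flip: sum_divide_distrib)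
    also have "\<dots> \<le> (\<Sum>h\<in>C - A. ?x h)"
      by (intro sum_mono x_ge)
    finally show ?thesis
      using sum_split sum_A False by (simp add: C_def)
  qed
qed

text \<open>Without the cap, exchanging the sums charges each rejected \<open>e\<close> with
  \<open>1/k\<close> times the weight of \<open>D e\<close>, at most \<open>c * w e\<close>. Edges
  of \<open>F \<inter> H\<close> pay for themselves since \<open>c \<ge> 1\<close>.\<close>

lemma spread_solution_cost:
  assumes "finite H" and "finite F" and "k > 0" and "c \<ge> 1"
    and D: "\<And>e. e \<in> F - H \<Longrightarrow> D e \<subseteq> H"
    and D_weight: "\<And>e. e \<in> F - H \<Longrightarrow> (\<Sum>h\<in>D e. real (w h)) \<le> c * real k * real (w e)"
  shows "(\<Sum>h\<in>H. real (w h) * spread_solution k F H D h) \<le> c * (\<Sum>e\<in>F. real (w e))"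
proof -
  let ?n = "\<lambda>h. real (card {e \<in> F - H. h \<in> D e})"
  have "(\<Sum>h\<in>H. real (w h) * spread_solution k F H D h)
      \<le> (\<Sum>h\<in>H. (if h \<in> F then real (w h) else 0) + real (w h) * (?n h / real k))"
    by (intro sum_mono)
      (auto simp: spread_solution_def simp del: times_divide_eq_right intro!: mult_left_mono)
  also have "\<dots> = (\<Sum>h\<in>F \<inter> H. real (w h)) + (\<Sum>h\<in>H. real (w h) * ?n h) / real k"
    using sum.inter_restrict[OF assms(1), of "\<lambda>h. real (w h)" F]
    by (simp add: sum.distrib Int_commute sum_divide_distrib)
  also have "(\<Sum>h\<in>H. real (w h) * ?n h) = (\<Sum>h\<in>H. \<Sum>e | e \<in> F - H \<and> h \<in> D e. real (w h))"
    by (simp add: mult.commute)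
  also have "\<dots> = (\<Sum>e\<in>F - H. \<Sum>h | h \<in> H \<and> h \<in> D e. real (w h))"
    using assms(1,2) by (intro sum.swap_restrict) auto
  also have "\<dots> = (\<Sum>e\<in>F - H. \<Sum>h\<in>D e. real (w h))"
    using D by (intro sum.cong refl) auto
  also have "\<dots> / real k \<le> (\<Sum>e\<in>F - H. c * real k * real (w e)) / real k"
    using D_weight by (intro divide_right_mono sum_mono) auto
  also have "\<dots> = c * (\<Sum>e\<in>F - H. real (w e))"
    using assms(3) by (simp add: sum_distrib_left sum_divide_distrib)
  also have "(\<Sum>h\<in>F \<inter> H. real (w h)) \<le> c * (\<Sum>h\<in>F \<inter> H. real (w h))"
    using assms(4) mult_right_mono[of 1 c "\<Sum>h\<in>F \<inter> H. real (w h)"] by (simp add: sum_nonneg)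
  also have "c * (\<Sum>h\<in>F \<inter> H. real (w h)) + c * (\<Sum>e\<in>F - H. real (w e)) = c * (\<Sum>e\<in>F. real (w e))"
    using sum.Int_Diff[OF assms(2), of "\<lambda>e. real (w e)" H] by (simp add: distrib_left)
  finally show ?thesis by simp
qed

lemma finite_requirements:
  assumes "finite V"
  shows "finite {r {u, v} | u v. u \<in> V \<and> v \<in> V \<and> u \<noteq> v}"
  by (rule finite_subset[of _ "(\<lambda>(u, v). r {u, v}) ` (V \<times> V)"]) (use assms in auto)

lemma requirement_le_max:
  assumes "finite V" "u \<in> V" "v \<in> V" "u \<noteq> v"
  shows "r {u, v} \<le> max_requirement V r"
  unfolding max_requirement_def
  using finite_requirements[OF assms(1), of r] assms by (intro Max_ge) auto

lemma cut_requirement_attained: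
  assumes "finite V" and "S \<noteq> {}" and "S \<subset> V"
  obtains u v where "u \<in> S" "v \<in> V - S" "Max {r {u, v} | u v. u \<in> S \<and> v \<in> V - S} = r {u, v}"
proof -
  let ?X = "{r {u, v} | u v. u \<in> S \<and> v \<in> V - S}"
  have "finite ?X"
    by (rule finite_subset[OF _ finite_requirements[OF assms(1), of r]]) (use assms in auto)
  moreover have "?X \<noteq> {}" using assms by auto
  ultimately have "Max ?X \<in> ?X" by (rule Max_in)
  then show ?thesis using that by auto
qed

lemma sndp_opt_attained:
  assumes "finite E" and "sndp_feasible V r E"
  obtains F where "F \<subseteq> E" "sndp_feasible V r F" "sndp_opt V E w r = (\<Sum>e\<in>F. w e)"
proof -
  let ?X = "{(\<Sum>e\<in>F. w e) | F. F \<subseteq> E \<and> sndp_feasible V r F}"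
  have "finite ?X"
    by (rule finite_subset[of _ "(\<lambda>F. \<Sum>e\<in>F. w e) ` Pow E"]) (use assms in auto)
  moreover have "?X \<noteq> {}" using assms by auto
  ultimately have "Min ?X \<in> ?X" by (rule Min_in)
  then show ?thesis using that by (auto simp: sndp_opt_def)
qed

lemma ugraph_finite_edges:
  assumes "ugraph V E"
  shows "finite E"
  by (rule finite_subset[of _ "Pow V"]) (use assms in \<open>auto simp: ugraph_def\<close>)

lemma rejected_edge_detours:
  fixes \<epsilon> :: real
  assumes "u \<noteq> v" and "{u, v} \<in> set es" and "real (w {u, v}) \<in> bucket \<epsilon> j"
    and "{u, v} \<notin> fold (eft_step t f \<epsilon> w) es (\<lambda>_. {}) j"
    and "k > 0" and "t \<ge> 1" and f: "f = (2 * int t - 1) * (2 * int k - 1)"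
    and \<epsilon>: "\<epsilon> = 1 / (2 * real t - 1)"
  shows "\<exists>D\<subseteq>fold (eft_step t f \<epsilon> w) es (\<lambda>_. {}) j.
           (\<Sum>h\<in>D. real (w h)) \<le> 4 * real t * real k * real (w {u, v}) \<and>
           (\<forall>S. card ({u, v} \<inter> S) = 1 \<longrightarrow> 2 * k \<le> card (cut_edges D S))"
proof -
  let ?Hj = "fold (eft_step t f \<epsilon> w) es (\<lambda>_. {}) j"
  have Hj: "?Hj \<subseteq> {e \<in> set es. real (w e) \<in> bucket \<epsilon> j}"
    using fold_eft_step_subset[of t f \<epsilon> w es "\<lambda>_. {}" j] by simp
  obtain K where K: "K \<subseteq> ?Hj"
    "\<forall>F\<subseteq>K. int (card F) \<le> f \<longrightarrow>
       (\<exists>p. is_path (K - F) u v p \<and> length (path_edges p) \<le> 2 * t - 1)"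
    using rejected_edge_short_path[OF assms(2-4)] by auto
  have "finite K"
    using K(1) Hj finite_subset[of K "set es"] by auto
  have "f = int ((2 * t - 1) * (2 * k - 1))"
    using f assms(5,6) by simp
  then obtain D where D: "D \<subseteq> K" "card D \<le> (2 * t - 1) * (2 * k)"
    "\<And>S. (u \<in> S) \<noteq> (v \<in> S) \<Longrightarrow> 2 * k \<le> card (cut_edges D S)"
    using fault_tolerant_detours[OF \<open>finite K\<close>, of "2 * t - 1" "2 * k" u v] K(2)
    by (metis of_nat_le_iff)
  have "\<epsilon> > 0" using \<epsilon> assms(6) by simp
  have "(\<Sum>h\<in>D. real (w h)) \<le> real (card D) * ((1 + \<epsilon>) * real (w {u, v}))"
    using D(1) K(1) Hj bucket_ratio[OF _ assms(3) \<open>\<epsilon> > 0\<close>] by (intro sum_bounded_above) auto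
  also have "\<dots> \<le> real ((2 * t - 1) * (2 * k)) * ((1 + \<epsilon>) * real (w {u, v}))"
    using D(2) \<open>\<epsilon> > 0\<close> by (intro mult_right_mono) (simp_all only: of_nat_le_iff, simp)
  also have "\<dots> = ((2 * real t - 1) * (1 + \<epsilon>)) * (2 * real k * real (w {u, v}))"
    using assms(6) by simp
  also have "(2 * real t - 1) * (1 + \<epsilon>) = 2 * real t"
    using assms(6) by (simp add: \<epsilon> field_simps)
  finally have "(\<Sum>h\<in>D. real (w h)) \<le> 4 * real t * real k * real (w {u, v})"
    by simp
  moreover have "2 * k \<le> card (cut_edges D S)" if "card ({u, v} \<inter> S) = 1" for S
    using that assms(1) by (intro D(3)) (auto simp: Int_insert_left split: if_splits)
  ultimately show ?thesis
    using D(1) K(1) by blast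
qed

theorem theorem3p6:
  fixes V :: "'a set" and E :: "'a set set" and w r :: "'a set \<Rightarrow> nat"
    and W T t k :: nat and f :: int and \<epsilon> :: real and es :: "'a set list"
  assumes "ugraph V E"
    and "\<forall>e\<in>E. w e \<in> {0..W}"
    and "sndp_feasible V r E"
    and "k = max_requirement V r"
    and "t \<ge> 1"
    and "f = (2 * int t - 1) * (2 * int k - 1)"
    and "\<epsilon> = 1 / (2 * real t - 1)"
    and "real ` {1..W} \<subseteq> (\<Union>i\<in>{1..T}. bucket \<epsilon> i)"
    and "distinct es" and "set es = E"
  shows "lp_opt V (eft_spanner t f \<epsilon> T w es) w r \<le> ereal (4 * real t * real (sndp_opt V E w r))"
proof -
  define Hj where "Hj = fold (eft_step t f \<epsilon> w) es (\<lambda>_. {})"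
  define H where "H = eft_spanner t f \<epsilon> T w es"
  have H_eq: "H = (\<Union>i\<le>T. Hj i)"
    by (simp add: H_def Hj_def eft_spanner_def)
  have finV: "finite V" and finE: "finite E"
    using assms(1) ugraph_finite_edges by (auto simp: ugraph_def)
  have "Hj i \<subseteq> E" for i
    using fold_eft_step_subset[of t f \<epsilon> w es "\<lambda>_. {}" i] assms(10) by (auto simp: Hj_def)
  then have finH: "finite H"
    using finE finite_subset[of H E] by (auto simp: H_eq)
  obtain F where F: "F \<subseteq> E" "sndp_feasible V r F" "sndp_opt V E w r = (\<Sum>e\<in>F. w e)"
    using sndp_opt_attained[OF finE assms(3)] .
  have finF: "finite F" using F(1) finE finite_subset by blast
  have "\<exists>x. lp_feasible V H r x \<and> (\<Sum>h\<in>H. real (w h) * x h) \<le> 4 * real t * (\<Sum>e\<in>F. real (w e))"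
  proof (cases "k = 0")
    case True
    have "lp_feasible V H r (\<lambda>_. 0)"
      unfolding lp_feasible_def
    proof (intro conjI allI impI)
      fix S assume S: "S \<noteq> {} \<and> S \<subset> V"
      obtain u v where uv: "u \<in> S" "v \<in> V - S"
        "Max {r {u, v} | u v. u \<in> S \<and> v \<in> V - S} = r {u, v}"
        using cut_requirement_attained[OF finV conjunct1[OF S] conjunct2[OF S], of r] .
      have "u \<in> V" "v \<in> V" "u \<noteq> v" using uv(1,2) S by auto
      then have "r {u, v} = 0"
        using requirement_le_max[OF finV, of u v r] assms(4) True by simp
      with uv show "real (Max {r {u, v} | u v. u \<in> S \<and> v \<in> V - S}) \<le> (\<Sum>e\<in>cut_edges H S. 0)"
        by simp
    qed simp
    then show ?thesis
      by (intro exI[of _ "\<lambda>_. 0"]) (simp add: sum_nonneg)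
  next
    case False
    have "\<exists>D\<subseteq>H. (\<Sum>h\<in>D. real (w h)) \<le> 4 * real t * real k * real (w e) \<and>
            (\<forall>S. card (e \<inter> S) = 1 \<longrightarrow> 2 * k \<le> card (cut_edges D S))" if e: "e \<in> F - H" for e
    proof -
      have "e \<in> E" using e F(1) by blast
      then obtain u v where uv: "u \<noteq> v" "e = {u, v}"
        using assms(1) by (auto simp: ugraph_def)
      obtain j where j: "j \<le> T" "real (w e) \<in> bucket \<epsilon> j"
      proof (cases "w e = 0")
        case True
        then show ?thesis using that[of 0] by (simp add: bucket_def)
      next
        case False
        then have "w e \<in> {1..W}" using assms(2) \<open>e \<in> E\<close> by auto
        then have "real (w e) \<in> (\<Union>i\<in>{1..T}. bucket \<epsilon> i)" using assms(8) by blast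
        then show ?thesis using that by auto
      qed
      have "e \<notin> Hj j" using e j(1) by (auto simp: H_eq)
      moreover have "Hj j \<subseteq> H" using j(1) by (auto simp: H_eq)
      ultimately show ?thesis
        using rejected_edge_detours[OF uv(1), of es w \<epsilon> j t f k] uv(2) j(2) \<open>e \<in> E\<close> False
          assms(5-7,10) unfolding Hj_def by (metis neq0_conv subset_trans)
    qed
    then obtain D where D: "\<And>e. e \<in> F - H \<Longrightarrow> D e \<subseteq> H"
      "\<And>e. e \<in> F - H \<Longrightarrow> (\<Sum>h\<in>D e. real (w h)) \<le> 4 * real t * real k * real (w e)"
      "\<And>e S. e \<in> F - H \<Longrightarrow> card (e \<inter> S) = 1 \<Longrightarrow> 2 * k \<le> card (cut_edges (D e) S)"
      by metis
    let ?x = "spread_solution k F H D"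
    have "lp_feasible V H r ?x"
      unfolding lp_feasible_def
    proof (intro conjI allI impI)
      fix S assume S: "S \<noteq> {} \<and> S \<subset> V"
      obtain u v where uv: "u \<in> S" "v \<in> V - S"
        "Max {r {u, v} | u v. u \<in> S \<and> v \<in> V - S} = r {u, v}"
        using cut_requirement_attained[OF finV conjunct1[OF S] conjunct2[OF S], of r] .
      have "u \<in> V" "v \<in> V" "u \<noteq> v" using uv(1,2) S by auto
      then have "has_edge_disjoint_paths F u v (r {u, v})" "r {u, v} \<le> k"
        using F(2) requirement_le_max[OF finV] assms(4) by (auto simp: sndp_feasible_def)
      then have "real (r {u, v}) \<le> (\<Sum>h\<in>cut_edges H S. ?x h)"
        using uv finH finF D edge_disjoint_paths_le_cut[of F u v "r {u, v}" S]
        by (intro spread_solution_cut) (auto simp: cut_edges_def)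
      with uv show "real (Max {r {u, v} | u v. u \<in> S \<and> v \<in> V - S}) \<le> (\<Sum>h\<in>cut_edges H S. ?x h)"
        by simp
    qed (simp add: spread_solution_def)
    moreover have "(\<Sum>h\<in>H. real (w h) * ?x h) \<le> 4 * real t * (\<Sum>e\<in>F. real (w e))"
      using finH finF D False assms(5) by (intro spread_solution_cost) auto
    ultimately show ?thesis by blast
  qed
  then obtain x where x: "lp_feasible V H r x"
    "(\<Sum>h\<in>H. real (w h) * x h) \<le> 4 * real t * (\<Sum>e\<in>F. real (w e))"
    by blast
  have "lp_opt V H w r \<le> ereal (\<Sum>h\<in>H. real (w h) * x h)"
    unfolding lp_opt_def using x(1) by (intro INF_lower) simp
  also have "\<dots> \<le> ereal (4 * real t * real (sndp_opt V E w r))"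
    using x(2) F(3) by simp
  finally show ?thesis by (simp add: H_def)
qed

end
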